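(* Let $h\in\mathcal{S}^*(\psi)$ and $\varphi\in\mathcal{B}_s$. If $g'(z)=\varphi(z)h'(z)$ for all $z\in\mathbb{D}$, then the harmonic functions $f=h+\bar g$ are univalent and close-to-convex in $|z|<r=\min\{r_0,r_c\}$, where $r_c$ is the radius of convexity for the class $\mathcal{S}^*(\psi)$ and $r_0$ is the minimal positive root of the equation $$(1-r)H_\psi(r)-r=0$$ with $$H_\psi(r):=\min_{0<|z|=r}\Re\left(1+\frac{zh''(z)}{h'(z)}\right).$$
   Context: $\mathbb{D}=\{z:|z|<1\}$, and $g$ is analytic in $\mathbb{D}$. $\psi$ is a univalent analytic function in $\mathbb{D}$ with $\psi(z)=1+p_1z+p_2z^2+\cdots$ and positive real part in $\mathbb{D}$; as a standing assumption, $\psi$ has positive coefficients in its power series expansion. $\mathcal{S}^*(\psi)$ is the class of analytic functions $h$ in $\mathbb{D}$ with $h(0)=0$, $h'(0)=1$ and $zh'(z)/h(z)\prec\psi(z)$, where $\prec$ denotes subordination. $\mathcal{B}_s$ is the class of analytic functions $\varphi:\mathbb{D}\to\mathbb{D}$ such that $|\varphi(z)|\le 1$ for all $z\in\mathbb{D}$. The radius of convexity of $\mathcal{S}^*(\psi)$ is the largest $\rho\in(0,1]$ such that every function in $\mathcal{S}^*(\psi)$ maps $\{|z|<\rho\}$ univalently onto a convex domain. A domain is close-to-convex if its complement can be written as a union of half-lines such that the corresponding open half-lines are disjoint; $f$ is univalent and close-to-convex in $|z|<\rho$ if it maps this disk univalently onto a close-to-convex domain. In the definition of $H_\psi$, $h$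 is the given function in $\mathcal{S}^*(\psi)$. *)

theory Defs
  imports "HOL-Complex_Analysis.Complex_Analysis"
begin

abbreviation unit_disk :: "complex set" where
  "unit_disk \<equiv> ball 0 1"

definition univalent_on :: "(complex \<Rightarrow> complex) \<Rightarrow> complex set \<Rightarrow> bool" where
  "univalent_on f S \<longleftrightarrow> f holomorphic_on S \<and> inj_on f S"

definition subordinate :: "(complex \<Rightarrow> complex) \<Rightarrow> (complex \<Rightarrow> complex) \<Rightarrow> bool" where
  "subordinate F G \<longleftrightarrow>
     F holomorphic_on unit_disk \<and> G holomorphic_on unit_disk \<and>
     (\<exists>w. w holomorphic_on unit_disk \<and> w 0 = 0 \<and> w ` unit_disk \<subseteq> unit_disk \<and>
          (\<forall>z\<in>unit_disk. F z = G (w z)))"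

definition admissible_psi :: "(complex \<Rightarrow> complex) \<Rightarrow> bool" where
  "admissible_psi \<psi> \<longleftrightarrow>
     univalent_on \<psi> unit_disk \<and> \<psi> 0 = 1 \<and> (\<forall>z\<in>unit_disk. 0 < Re (\<psi> z)) \<and>
     (\<exists>p :: nat \<Rightarrow> real. (\<forall>n. 0 < p n) \<and>
        (\<forall>z\<in>unit_disk. (\<lambda>n. complex_of_real (p n) * z ^ n) sums \<psi> z))"

(* The removable singularity of z h'(z) / h(z) at the origin is filled with its limit 1. The
   condition that h has no other zero only keeps the convention x / 0 = 0 from playing a role. *)
definition starlike_class :: "(complex \<Rightarrow> complex) \<Rightarrow> (complex \<Rightarrow> complex) set" where
  "starlike_class \<psi> =
     {h. h holomorphic_on unit_disk \<and> h 0 = 0 \<and> deriv h 0 = 1 \<and>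
         (\<forall>z\<in>unit_disk - {0}. h z \<noteq> 0) \<and>
         subordinate (\<lambda>z. if z = 0 then 1 else z * deriv h z / h z) \<psi>}"

(* The target is the open disk, which implies norm (phi z) \<le> 1 and excludes the unimodular
   constants. For these h + cnj g takes values in a line and is not injective. *)
definition schwarz_class :: "(complex \<Rightarrow> complex) set" where
  "schwarz_class = {\<phi>. \<phi> holomorphic_on unit_disk \<and> \<phi> ` unit_disk \<subseteq> unit_disk}"

definition maps_onto_convex_domain :: "(complex \<Rightarrow> complex) \<Rightarrow> complex set \<Rightarrow> bool" where
  "maps_onto_convex_domain h S \<longleftrightarrow>
     univalent_on h S \<and> open (h ` S) \<and> h ` S \<noteq> {} \<and> convex (h ` S)"

definition is_radius_of_convexity :: "(complex \<Rightarrow> complex) set \<Rightarrow> real \<Rightarrow> bool" where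
  "is_radius_of_convexity \<F> \<rho> \<longleftrightarrow>
     (let R = {s. 0 < s \<and> s \<le> 1 \<and> (\<forall>h\<in>\<F>. maps_onto_convex_domain h (ball 0 s))}
      in \<rho> \<in> R \<and> (\<forall>s\<in>R. s \<le> \<rho>))"

definition half_line :: "complex \<times> complex \<Rightarrow> complex set" where
  "half_line = (\<lambda>(a, d). {a + of_real t * d | t. 0 \<le> t})"

definition open_half_line :: "complex \<times> complex \<Rightarrow> complex set" where
  "open_half_line = (\<lambda>(a, d). {a + of_real t * d | t. 0 < t})"

definition close_to_convex_domain :: "complex set \<Rightarrow> bool" where
  "close_to_convex_domain S \<longleftrightarrow>
     open S \<and> connected S \<and> S \<noteq> {} \<and>
     (\<exists>L. (\<forall>(a, d)\<in>L. d \<noteq> 0) \<and> - S = (\<Union>l\<in>L. half_line l) \<and>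
          disjoint_family_on open_half_line L)"

definition univalent_close_to_convex_on :: "(complex \<Rightarrow> complex) \<Rightarrow> complex set \<Rightarrow> bool" where
  "univalent_close_to_convex_on f S \<longleftrightarrow> inj_on f S \<and> close_to_convex_domain (f ` S)"

(* For h in the starlike class and 0 < r < 1 the infimum is a minimum: h' has no zero in the unit
   disk, so the function is continuous on the circle. *)
definition H_min :: "(complex \<Rightarrow> complex) \<Rightarrow> real \<Rightarrow> real" where
  "H_min h r = (INF z\<in>{z. 0 < norm z \<and> norm z = r}. Re (1 + z * deriv (deriv h) z / deriv h z))"

(* Roots are sought below 1, since h is only given in the unit disk. *)
definition is_minimal_positive_root :: "(complex \<Rightarrow> complex) \<Rightarrow> real \<Rightarrow> bool" where
  "is_minimal_positive_root h \<rho> \<longleftrightarrow>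
     (let R = {s. 0 < s \<and> s < 1 \<and> (1 - s) * H_min h s - s = 0}
      in \<rho> \<in> R \<and> (\<forall>s\<in>R. \<rho> \<le> s))"

end

theory Submission
  imports Defs
begin

text \<open>
  Put \<open>r = min r\<^sub>0 r\<^sub>c\<close>. By Schwarz' lemma \<open>\<Omega> = h ` ball 0 r\<close> is convex. On \<open>\<Omega>\<close> the function
  \<open>G = g \<circ> h\<^sup>-\<^sup>1\<close> has derivative \<open>\<phi> \<circ> h\<^sup>-\<^sup>1\<close>, and \<open>r < 1\<close>, so \<open>G\<close> is \<open>k\<close>-Lipschitz with some \<open>k < 1\<close>
  and extends to \<open>closure \<Omega>\<close>. Let \<open>P\<close> be the closest point
  projection onto \<open>closure \<Omega>\<close>. The map \<open>E w = w + cnj (G (P w))\<close> is a contractive perturbation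
  of the identity, hence a bijection of the plane. Outside \<open>\<Omega>\<close> the plane is the union of the rays
  that leave \<open>closure \<Omega>\<close> in normal directions. Since \<open>P\<close> is constant on each of these rays, \<open>E\<close>
  translates each of them, and the translated rays fill the complement of the image.
\<close>

section \<open>Outer normal rays of a convex set\<close>

text \<open>Expanding the square of \<open>norm (n - (y - p))\<close> gives the square of
  \<open>norm n\<close> plus two terms, and the sign condition on \<open>inner n (y - p)\<close>
  makes both nonnegative.\<close>

lemma closest_point_outer_normal:
  fixes S :: "'a::euclidean_space set"
  assumes "convex S" "closed S" "p \<in> S" "\<And>y. y \<in> S \<Longrightarrow> inner n (y - p) \<le> 0"
  shows "closest_point S (p + n) = p"
proof -
  have "dist (p + n) p \<le> dist (p + n) y" if "y \<in> S" for y
  proof -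
    have "(norm (p + n - p))\<^sup>2 \<le> (norm (n - (y - p)))\<^sup>2"
      using assms(4)[OF that] inner_ge_zero[of "y - p"]
      by (simp add: power2_norm_eq_inner inner_diff_left inner_diff_right inner_commute)
    then have "norm (p + n - p) \<le> norm (n - (y - p))"
      by (rule power2_le_imp_le) simp
    then show ?thesis
      by (simp add: dist_norm algebra_simps)
  qed
  then show ?thesis
    using closest_point_unique[OF assms(1-3), of "p + n"] by simp
qed

text \<open>A boundary point starts a ray normal to a supporting line or hyperplane, so
  \<open>t = 0\<close> there. A point off the closure lies on the ray that leaves its nearest point
  in its own direction.\<close>

lemma outer_normal_ray_through:
  fixes S :: "'a::euclidean_space set"
  assumes S: "convex S" "open S" "S \<noteq> {}" and w: "w \<notin> S"
  obtains p n t where "p \<in> closure S" "norm n = 1" "\<And>y. y \<in> closure S \<Longrightarrow> inner n (y - p) \<le> 0"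
    "0 \<le> t" "w = p + t *\<^sub>R n"
proof (cases "w \<in> closure S")
  case True
  obtain a b where a: "a \<noteq> 0" "inner a w \<le> b" "\<forall>x\<in>S. b \<le> inner a x"
    using separating_hyperplane_sets[of "{w}" S] S w by auto
  have "closure S \<subseteq> {x. b \<le> inner a x}"
    using a by (intro closure_minimal closed_halfspace_ge) auto
  \<comment> \<open>The separating functional is at least \<open>b\<close> on \<open>S\<close>, so
    \<open>a\<close> points inward and the outer unit normal is \<open>- sgn a\<close>.\<close>
  then have "inner (- sgn a) (y - w) \<le> 0" if "y \<in> closure S" for y
    using that a by (auto simp: sgn_div_norm inner_diff_right field_simps)
  then show ?thesis
    using that[of w "- sgn a" 0] True a by (simp add: norm_sgn)
next
  case False
  define p where "p = closest_point (closure S) w"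
  have p: "p \<in> closure S"
    using S by (simp add: p_def closest_point_in_set)
  have "w - p \<noteq> 0"
    using False p by auto
  moreover have "inner (sgn (w - p)) (y - p) \<le> 0" if "y \<in> closure S" for y
    using closest_point_dot[OF convex_closure[OF S(1)] closed_closure that, of w]
    by (simp add: p_def sgn_div_norm mult_nonneg_nonpos divide_nonpos_nonneg)
  ultimately show ?thesis
    using that[of p "sgn (w - p)" "norm (w - p)"] p
    by (simp add: norm_sgn) (simp add: sgn_div_norm)
qed

text \<open>If a point of the ray were in the open set, a point slightly further along
  \<open>n\<close> would be too, and its inner product with \<open>n\<close> relative to
  \<open>p\<close> would be positive. This covers the foot point \<open>t = 0\<close> as
  well.\<close>

lemma outer_normal_ray_disjoint:
  fixes S :: "'a::euclidean_space set"
  assumes "open S" "norm n = 1" "\<And>y. y \<in> closure S \<Longrightarrow> inner n (y - p) \<le> 0" "0 \<le> t"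
  shows "p + t *\<^sub>R n \<notin> S"
proof
  assume "p + t *\<^sub>R n \<in> S"
  then obtain e where e: "e > 0" "cball (p + t *\<^sub>R n) e \<subseteq> S"
    using \<open>open S\<close> open_contains_cball by blast
  have "p + t *\<^sub>R n + e *\<^sub>R n \<in> cball (p + t *\<^sub>R n) e"
    using assms(2) e(1) by (simp add: dist_norm)
  then have "inner n (p + t *\<^sub>R n + e *\<^sub>R n - p) \<le> 0"
    using assms(3) e(2) closure_subset by blast
  then have "t + e \<le> 0"
    using assms(2) by (simp add: inner_add_right norm_eq_1)
  then show False
    using e(1) assms(4) by linarith
qed

section \<open>Contractive perturbations of the identity\<close>

text \<open>Two points with the same image would have to be as far apart as their values under
  \<open>G\<close>. A preimage of \<open>y\<close> is a fixed point of the contraction taking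
  \<open>x\<close> to \<open>y - G x\<close>.\<close>

lemma contractive_perturbation_of_identity_bij:
  fixes G :: "'a::banach \<Rightarrow> 'a"
  assumes G: "k-lipschitz_on UNIV G" and k: "k < 1"
  shows "bij (\<lambda>x. x + G x)"
proof (rule bijI)
  have k0: "0 \<le> k"
    using G by (rule lipschitz_on_nonneg)
  have lip: "dist (G x) (G y) \<le> k * dist x y" for x y
    using lipschitz_onD[OF G] by simp
  show "inj (\<lambda>x. x + G x)"
  proof (rule injI, rule ccontr)
    fix x y
    assume eq: "x + G x = y + G y" and "x \<noteq> y"
    have "x - y = G y - G x"
      using eq by (simp add: algebra_simps)
    then have "dist x y = dist (G x) (G y)"
      by (simp add: dist_norm norm_minus_commute)
    also have "\<dots> < dist x y"
      using lip[of x y] k \<open>x \<noteq> y\<close>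
      by (smt (verit) mult_less_cancel_right2 zero_less_dist_iff)
    finally show False
      by simp
  qed
  have "\<exists>x. y = x + G x" for y
  proof -
    have "\<exists>!x\<in>UNIV. y - G x = x"
      using k k0 lip by (intro Banach_fix) (auto simp: complete_UNIV dist_norm norm_minus_commute)
    then obtain x where "y - G x = x"
      by blast
    then show ?thesis
      by (metis diff_add_cancel)
  qed
  then show "surj (\<lambda>x. x + G x)"
    unfolding surj_def by blast
qed

text \<open>The perturbation enters through its Lipschitz constant, so the lemma applies to
  antianalytic \<open>G\<close>.\<close>

lemma close_to_convex_contractive_perturbation:
  fixes G :: "complex \<Rightarrow> complex"
  assumes S: "convex S" "open S" "S \<noteq> {}" and lipG: "k-lipschitz_on S G" and k: "k < 1"
  shows "univalent_close_to_convex_on (\<lambda>w. w + G w) S"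
proof -
  let ?P = "closest_point (closure S)"
  obtain G' where G': "k-lipschitz_on (closure S) G'" "\<And>x. x \<in> S \<Longrightarrow> G' x = G x"
    using lipschitz_extend_closure[OF lipG] by blast
  have convc: "convex (closure S)" and nec: "closure S \<noteq> {}"
    using S by (auto intro: convex_closure)
  have "1-lipschitz_on UNIV ?P"
    using closest_point_lipschitz[OF convc closed_closure nec] by (intro lipschitz_onI) auto
  moreover have "k-lipschitz_on (range ?P) G'"
    using G'(1) by (rule lipschitz_on_subset) (use closest_point_in_set[OF closed_closure nec] in blast)
  \<comment> \<open>The projection has Lipschitz constant 1, so the extension to the whole plane
    keeps the constant \<open>k\<close>.\<close>
  ultimately have lip: "k-lipschitz_on UNIV (\<lambda>w. G' (?P w))"
    using lipschitz_on_compose[of 1 UNIV ?P k G'] by (simp add: o_def)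
  define E where "E w = w + G' (?P w)" for w
  have E: "bij E"
    unfolding E_def using contractive_perturbation_of_identity_bij[OF lip k] .
  have E_eq: "E w = w + G w" if "w \<in> S" for w
    using that closure_subset[of S] by (auto simp: E_def closest_point_self G'(2))
  then have img: "(\<lambda>w. w + G w) ` S = E ` S"
    by simp
  have inj: "inj_on (\<lambda>w. w + G w) S"
    using inj_on_subset[OF bij_is_inj[OF E], of S] by (simp add: inj_on_def E_eq)
  have cont: "continuous_on S (\<lambda>w. w + G w)"
    by (intro continuous_intros lipschitz_on_continuous_on[OF lipG])
  \<comment> \<open>Foot points paired with outer normals. Normalising \<open>n\<close> keeps one
    ray from being listed under directions of different lengths.\<close>
  define N where
    "N = {(p, n). p \<in> closure S \<and> norm n = 1 \<and> (\<forall>y\<in>closure S. inner n (y - p) \<le> 0)}"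
  have P_ray: "?P (p + of_real t * n) = p" if "(p, n) \<in> N" "0 \<le> t" for p n t
    unfolding scaleR_conv_of_real[symmetric]
    by (rule closest_point_outer_normal[OF convc closed_closure])
      (use that in \<open>auto simp: N_def mult_nonneg_nonpos\<close>)
  have E_ray: "E (p + of_real t * n) = E p + of_real t * n" if "(p, n) \<in> N" "0 \<le> t" for p n t
    using P_ray[OF that] P_ray[OF that(1), of 0] by (simp add: E_def)
  define L where "L = (\<lambda>(p, n). (E p, n)) ` N"
  have "- (E ` S) = E ` (- S)"
    using bij_image_Compl_eq[OF E] by simp
  also have "- S = (\<Union>(p, n)\<in>N. {p + of_real t * n | t. 0 \<le> t})"
  proof (intro equalityI subsetI)
    fix w assume "w \<in> - S"
    then obtain p n t where "p \<in> closure S" "norm n = 1"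
      "\<And>y. y \<in> closure S \<Longrightarrow> inner n (y - p) \<le> 0" "0 \<le> t" "w = p + t *\<^sub>R n"
      using outer_normal_ray_through[OF S] by (metis ComplD)
    then show "w \<in> (\<Union>(p, n)\<in>N. {p + of_real t * n | t. 0 \<le> t})"
      by (intro UN_I[of "(p, n)"]) (auto simp: N_def scaleR_conv_of_real)
  next
    fix w assume "w \<in> (\<Union>(p, n)\<in>N. {p + of_real t * n | t. 0 \<le> t})"
    then obtain p n t where "(p, n) \<in> N" "0 \<le> t" "w = p + t *\<^sub>R n"
      by (auto simp: scaleR_conv_of_real)
    then show "w \<in> - S"
      using outer_normal_ray_disjoint[OF S(2), of n p t] by (auto simp: N_def)
  qed
  also have "E ` \<dots> = (\<Union>(p, n)\<in>N. half_line (E p, n))"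
  proof -
    have "E ` {p + of_real t * n | t. 0 \<le> t} = half_line (E p, n)" if "(p, n) \<in> N" for p n
    proof -
      have "E ` {p + of_real t * n | t. 0 \<le> t} = (\<lambda>t. E (p + of_real t * n)) ` {0..}"
        by auto
      also have "\<dots> = (\<lambda>t. E p + of_real t * n) ` {0..}"
        using E_ray[OF that] by (intro image_cong) auto
      finally show ?thesis
        by (auto simp: half_line_def)
    qed
    then show ?thesis
      by (simp add: image_UN split_beta')
  qed
  also have "\<dots> = (\<Union>l\<in>L. half_line l)"
    by (simp add: L_def split_beta')
  finally have compl: "- (E ` S) = (\<Union>l\<in>L. half_line l)" .
  \<comment> \<open>A common point pulls back under \<open>E\<close> to a common point of two
    original rays. Projecting it gives equal feet, and unit length gives equal directions. Positive
    parameters matter: at a corner several closed rays share their origin.\<close>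
  have disj: "disjoint_family_on open_half_line L"
  proof (unfold disjoint_family_on_def, intro ballI impI, rule ccontr)
    fix l m
    assume "l \<in> L" "m \<in> L" and lm: "l \<noteq> m" "open_half_line l \<inter> open_half_line m \<noteq> {}"
    then obtain p n q n' where N: "(p, n) \<in> N" "(q, n') \<in> N"
      and l: "l = (E p, n)" and m: "m = (E q, n')"
      unfolding L_def by fast
    have ne: "(E p, n) \<noteq> (E q, n')"
      using lm(1) l m by simp
    from lm(2) obtain s t where st: "0 < s" "0 < t"
      and eq: "E p + of_real s * n = E q + of_real t * n'"
      unfolding l m open_half_line_def by auto
    have "E (p + of_real s * n) = E (q + of_real t * n')"
      using N st eq by (simp add: E_ray)
    then have pq: "p + of_real s * n = q + of_real t * n'"
      using bij_is_inj[OF E] by (simp add: inj_eq)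
    then have "p = q"
      using P_ray[OF N(1), of s] P_ray[OF N(2), of t] st by simp
    then have sn: "of_real s * n = of_real t * n'"
      using pq by simp
    have "norm (of_real s * n) = s" "norm (of_real t * n') = t"
      using N st by (auto simp: N_def norm_mult)
    then have "s = t"
      using sn by simp
    then show False
      using sn ne st \<open>p = q\<close> by simp
  qed
  have "\<forall>(a, d)\<in>L. d \<noteq> 0"
    by (auto simp: L_def N_def)
  moreover have "open (E ` S)" "connected (E ` S)"
    using invariance_of_domain[OF cont S(2) inj] connected_continuous_image[OF cont]
      convex_connected[OF S(1)] img by simp_all
  ultimately have "close_to_convex_domain (E ` S)"
    using S(3) compl disj unfolding close_to_convex_domain_def by blast
  then show ?thesis
    unfolding univalent_close_to_convex_on_def img using inj by blast
qed

lemma univalent_close_to_convex_on_compose: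
  assumes "inj_on h S" "univalent_close_to_convex_on F (h ` S)"
  shows "univalent_close_to_convex_on (\<lambda>z. F (h z)) S"
proof -
  have "(\<lambda>z. F (h z)) ` S = F ` h ` S"
    by auto
  moreover have "inj_on (\<lambda>z. F (h z)) S"
    using assms comp_inj_on[of h S F] by (simp add: univalent_close_to_convex_on_def o_def)
  ultimately show ?thesis
    using assms(2) by (simp add: univalent_close_to_convex_on_def)
qed

section \<open>Convexity of the images of smaller disks\<close>

text \<open>A convex combination of two rescaled copies of \<open>f\<close> stays in the convex
  image of the large disk, so composing it with the inverse of \<open>f\<close> gives a self-map of
  the disk fixing 0. Schwarz' lemma then bounds the preimage of the combination by the larger of the
  two moduli.\<close>

lemma convex_image_smaller_ball:
  fixes f :: "complex \<Rightarrow> complex"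
  assumes hol: "f holomorphic_on ball 0 R" and inj: "inj_on f (ball 0 R)"
    and conv: "convex (f ` ball 0 R)" and r: "r \<le> R"
  shows "convex (f ` ball 0 r)"
proof (rule convexI)
  obtain F where F: "F holomorphic_on (f ` ball 0 R)" "\<And>z. z \<in> ball 0 R \<Longrightarrow> F (f z) = z"
    using holomorphic_has_inverse[OF hol open_ball inj] by metis
  fix x y and u v :: real
  assume "x \<in> f ` ball 0 r" "y \<in> f ` ball 0 r" and uv: "0 \<le> u" "0 \<le> v" "u + v = 1"
  then obtain a b where a: "x = f a" "norm a < r" and b: "y = f b" "norm b < r"
    by auto
  define M where "M = max (norm a) (norm b)"
  have M: "norm a \<le> M" "norm b \<le> M" "M < r"
    using a b by (auto simp: M_def)
  show "u *\<^sub>R x + v *\<^sub>R y \<in> f ` ball 0 r"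
  proof (cases "M = 0")
    case True
    then have "y = x"
      using M a b by simp
    then have "u *\<^sub>R x + v *\<^sub>R y = x"
      using uv(3) by (metis scaleR_left_distrib scaleR_one)
    then show ?thesis
      using \<open>x \<in> f ` ball 0 r\<close> by simp
  next
    case False
    then have M0: "0 < M"
      using norm_ge_zero[of a] M(1) by linarith
    with M r have R0: "0 < R" "M < R"
      by linarith+
    have in_R: "of_real R * \<zeta> * (c / of_real M) \<in> ball 0 R"
      if "norm \<zeta> < 1" "norm c \<le> M" for \<zeta> c :: complex
    proof -
      have "norm \<zeta> * (norm c / M) \<le> norm \<zeta> * 1"
        using that(2) M0 by (intro mult_left_mono) auto
      then have "norm \<zeta> * (norm c / M) < 1"
        using that(1) by simp
      then have "R * (norm \<zeta> * (norm c / M)) < R * 1"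
        using R0(1) by (intro mult_strict_left_mono) auto
      then show ?thesis
        using R0 M0 by (simp add: norm_mult norm_divide mult.assoc)
    qed
    \<comment> \<open>The scaling carries the unit disk into \<open>ball 0 R\<close>, while \<zeta>
      = \<open>M / R\<close> gives back the points \<open>a\<close> and \<open>b\<close>.\<close>
    define m where "m \<zeta> = u *\<^sub>R f (of_real R * \<zeta> * (a / of_real M))
                        + v *\<^sub>R f (of_real R * \<zeta> * (b / of_real M))" for \<zeta>
    have m_in: "m \<zeta> \<in> f ` ball 0 R" if "norm \<zeta> < 1" for \<zeta>
      unfolding m_def by (rule convexD[OF conv]) (use in_R[OF that] M uv in auto)
    define \<omega> where "\<omega> \<zeta> = F (m \<zeta>) / of_real R" for \<zeta>
    have "(\<lambda>\<zeta>. f (of_real R * \<zeta> * (c / of_real M))) holomorphic_on ball 0 1"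
      if "norm c \<le> M" for c
    proof -
      have "f \<circ> (\<lambda>\<zeta>. of_real R * \<zeta> * (c / of_real M)) holomorphic_on ball 0 1"
        by (rule holomorphic_on_compose_gen[OF _ hol])
          (use in_R that M0 in \<open>auto intro!: holomorphic_intros simp del: mem_ball\<close>)
      then show ?thesis
        by (simp add: o_def)
    qed
    then have "m holomorphic_on ball 0 1"
      unfolding m_def scaleR_conv_of_real using M by (intro holomorphic_intros) auto
    then have "F \<circ> m holomorphic_on ball 0 1"
      by (rule holomorphic_on_compose_gen[OF _ F(1)]) (use m_in in auto)
    then have hol_\<omega>: "\<omega> holomorphic_on ball 0 1"
      unfolding \<omega>_def o_def using R0 by (intro holomorphic_intros) auto
    have "m 0 = f 0"
      using uv(3) by (simp add: m_def flip: scaleR_left_distrib)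
    then have \<omega>0: "\<omega> 0 = 0"
      using F(2)[of 0] R0 by (simp add: \<omega>_def)
    have \<omega>_lt: "norm (\<omega> \<zeta>) < 1" if \<zeta>: "norm \<zeta> < 1" for \<zeta>
    proof -
      have "F (m \<zeta>) \<in> ball 0 R"
        using m_in[OF \<zeta>] F(2) by auto
      then show ?thesis
        using R0 by (simp add: \<omega>_def norm_divide)
    qed
    have MR: "norm (of_real (M / R) :: complex) < 1"
      using M0 R0 by (simp add: norm_divide)
    have "norm (\<omega> (of_real (M / R))) \<le> norm (of_real (M / R) :: complex)"
      by (rule Schwarz_Lemma(1)[OF hol_\<omega> \<omega>0 \<omega>_lt MR])
    then have "norm (F (m (of_real (M / R)))) \<le> M"
      using M0 R0 by (simp add: \<omega>_def norm_divide divide_simps)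
    moreover have m_eq: "m (of_real (M / R)) = u *\<^sub>R x + v *\<^sub>R y"
      using M0 R0 a b by (simp add: m_def)
    ultimately have "F (u *\<^sub>R x + v *\<^sub>R y) \<in> ball 0 r"
      using M by simp
    moreover have "f (F (u *\<^sub>R x + v *\<^sub>R y)) = u *\<^sub>R x + v *\<^sub>R y"
      using m_in[OF MR] F(2) unfolding m_eq by auto
    ultimately show ?thesis
      by (metis imageI)
  qed
qed

section \<open>Harmonic maps with convex analytic part\<close>

text \<open>In the coordinate \<open>w = h z\<close> the map is the identity plus the conjugate of
  \<open>g (H w)\<close>, and the dilatation \<phi> becomes the derivative of this
  composition.\<close>

lemma harmonic_close_to_convex:
  fixes h g \<phi> :: "complex \<Rightarrow> complex"
  assumes S: "open S" "S \<noteq> {}"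
    and h: "h holomorphic_on S" "inj_on h S" "convex (h ` S)"
    and g: "g holomorphic_on S" "\<And>z. z \<in> S \<Longrightarrow> deriv g z = \<phi> z * deriv h z"
    and \<phi>: "\<And>z. z \<in> S \<Longrightarrow> norm (\<phi> z) \<le> k" and k: "k < 1"
  shows "univalent_close_to_convex_on (\<lambda>z. h z + cnj (g z)) S"
proof -
  obtain H where H: "H holomorphic_on (h ` S)"
    "\<And>z. z \<in> S \<Longrightarrow> deriv h z * deriv H (h z) = 1" "\<And>z. z \<in> S \<Longrightarrow> H (h z) = z"
    using holomorphic_has_inverse[OF h(1) S(1) h(2)] by metis
  have op: "open (h ` S)"
    using S(1) h by (intro invariance_of_domain holomorphic_on_imp_continuous_on)
  \<comment> \<open>The factor \<open>deriv h z\<close> in the derivative of \<open>g\<close>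
    cancels against the derivative of the inverse.\<close>
  have der: "((\<lambda>w. g (H w)) has_field_derivative \<phi> (H w)) (at w within h ` S)"
    if "w \<in> h ` S" for w
  proof -
    from that obtain z where z: "z \<in> S" "w = h z"
      by blast
    have dg: "(g has_field_derivative \<phi> z * deriv h z) (at (H w))"
      using holomorphic_derivI[OF g(1) S(1) z(1)] g(2) H(3) z by simp
    have "(H has_field_derivative deriv H w) (at w)"
      using H(1) op that by (rule holomorphic_derivI)
    from DERIV_chain2[OF dg this] have "((\<lambda>w. g (H w)) has_field_derivative \<phi> z) (at w)"
      using H(2)[OF z(1)] z by (simp add: mult.assoc)
    then show ?thesis
      using H(3) z by (simp add: has_field_derivative_at_within)
  qed
  have bd: "norm (\<phi> (H w)) \<le> k" if "w \<in> h ` S" for w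
    using that \<phi> H(3) by auto
  obtain z where "z \<in> S"
    using S(2) by blast
  with \<phi> have "0 \<le> k"
    using norm_ge_zero order_trans by blast
  \<comment> \<open>Convexity of the image turns the derivative bound into a Lipschitz bound, and
    conjugation is an isometry.\<close>
  then have "k-lipschitz_on (h ` S) (\<lambda>w. cnj (g (H w)))"
    using field_differentiable_bound[OF h(3) der bd]
    by (intro lipschitz_onI) (auto simp: dist_norm simp flip: complex_cnj_diff)
  then have "univalent_close_to_convex_on (\<lambda>w. w + cnj (g (H w))) (h ` S)"
    using close_to_convex_contractive_perturbation h(3) op S(2) k by simp
  then have "univalent_close_to_convex_on (\<lambda>z. h z + cnj (g (H (h z)))) S"
    by (rule univalent_close_to_convex_on_compose[OF h(2)])
  then show ?thesis
    using H(3) by (simp add: univalent_close_to_convex_on_def inj_on_def cong: image_cong)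
qed

text \<open>On a compact subdisk the modulus attains its maximum, which is below 1 because the
  target disk is open.\<close>

lemma schwarz_class_bound:
  assumes "\<phi> \<in> schwarz_class" "0 \<le> r" "r < 1"
  obtains k where "k < 1" "\<And>z. z \<in> cball 0 r \<Longrightarrow> norm (\<phi> z) \<le> k"
proof -
  have sub: "cball 0 r \<subseteq> unit_disk"
    using assms(3) by auto
  have "continuous_on (cball 0 r) (\<lambda>z. norm (\<phi> z))"
    using assms(1) sub
    by (auto simp: schwarz_class_def intro!: continuous_on_norm
        intro: continuous_on_subset holomorphic_on_imp_continuous_on)
  then obtain z where z: "z \<in> cball 0 r" "\<And>y. y \<in> cball 0 r \<Longrightarrow> norm (\<phi> y) \<le> norm (\<phi> z)"
    using continuous_attains_sup[OF compact_cball, of 0 r "\<lambda>z. norm (\<phi> z)"] assms(2) by auto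
  moreover have "norm (\<phi> z) < 1"
    using assms(1) sub z(1) by (force simp: schwarz_class_def)
  ultimately show ?thesis
    using that by blast
qed

theorem theorem7:
  fixes \<psi> h g \<phi> :: "complex \<Rightarrow> complex" and r\<^sub>0 r\<^sub>c :: real
  assumes "admissible_psi \<psi>"
    and "h \<in> starlike_class \<psi>"
    and "\<phi> \<in> schwarz_class"
    and "g holomorphic_on unit_disk"
    and "\<forall>z\<in>unit_disk. deriv g z = \<phi> z * deriv h z"
    and "is_radius_of_convexity (starlike_class \<psi>) r\<^sub>c"
    and "is_minimal_positive_root h r\<^sub>0"
  shows "univalent_close_to_convex_on (\<lambda>z. h z + cnj (g z)) (ball 0 (min r\<^sub>0 r\<^sub>c))"
proof -
  define r where "r = min r\<^sub>0 r\<^sub>c"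
  \<comment> \<open>The strict bound on \<open>r\<^sub>0\<close> keeps the closed disk of radius
    \<open>r\<close> inside the unit disk, where \<phi> is bounded away from modulus 1.\<close>
  have r0: "0 < r\<^sub>0" "r\<^sub>0 < 1"
    using assms(7) by (auto simp: is_minimal_positive_root_def Let_def)
  \<comment> \<open>As a maximum, \<open>r\<^sub>c\<close> is itself an admissible radius, so
    \<open>h\<close> is convex on the full disk \<open>ball 0 r\<^sub>c\<close>.\<close>
  have rc: "0 < r\<^sub>c" and "maps_onto_convex_domain h (ball 0 r\<^sub>c)"
    using assms(2,6) by (auto simp: is_radius_of_convexity_def Let_def)
  then have h: "h holomorphic_on ball 0 r\<^sub>c" "inj_on h (ball 0 r\<^sub>c)" "convex (h ` ball 0 r\<^sub>c)"
    by (auto simp: maps_onto_convex_domain_def univalent_on_def)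
  have r: "0 < r" "r < 1" "r \<le> r\<^sub>c"
    using r0 rc by (auto simp: r_def)
  then have sub: "ball 0 r \<subseteq> (unit_disk :: complex set)" "ball 0 r \<subseteq> (ball 0 r\<^sub>c :: complex set)"
    by auto
  obtain k where k: "k < 1" "\<And>z. z \<in> cball 0 r \<Longrightarrow> norm (\<phi> z) \<le> k"
    using schwarz_class_bound[OF assms(3)] r by (metis less_imp_le)
  have "univalent_close_to_convex_on (\<lambda>z. h z + cnj (g z)) (ball 0 r)"
  proof (rule harmonic_close_to_convex[where k = k])
    show "convex (h ` ball 0 r)"
      using convex_image_smaller_ball[OF h r(3)] .
    show "h holomorphic_on ball 0 r" "inj_on h (ball 0 r)"
      using h sub(2) by (auto intro: holomorphic_on_subset inj_on_subset)
    show "g holomorphic_on ball 0 r"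
      using assms(4) sub(1) by (rule holomorphic_on_subset)
    show "deriv g z = \<phi> z * deriv h z" if "z \<in> ball 0 r" for z
      using assms(5) sub(1) that by blast
  qed (use r k in auto)
  then show ?thesis
    by (simp add: r_def)
qed

end
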